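(* Let $\mathcal{M}$ be a matroid, let $I$ be an infinite index set, and let $\Pi\mathcal{M}=\prod_{i\in I}\mathcal{M}$ be the corresponding direct power. Then $\Pi\mathcal{M}$ is $\mathcal{L}_m(\Pi\mathcal{M})$-equationally Noetherian if and only if $\mathcal{M}$ satisfies both of the following axioms: $$\forall x\forall y\forall z\;\neg P_3(x,y,z),$$ $$\forall x_1\forall x_2\forall x_3\forall x_4\;\bigl(P_2(x_1,x_2)\wedge P_2(x_2,x_3)\wedge P_2(x_3,x_4)\to P_2(x_4,x_1)\bigr).$$
   Context: The matroid language is $\mathcal{L}_m=\{P_1^{(1)},P_2^{(2)},P_3^{(3)},\dots\}$, with one $n$-ary relation symbol $P_n$ for each $n\geq 1$. A matroid $\mathcal{M}$ is regarded as an $\mathcal{L}_m$-structure on its ground set, where $P_n(x_1,\dots,x_n)$ holds iff $x_1,\dots,x_n$ are pairwise distinct and the set $\{x_1,\dots,x_n\}$ is independent in $\mathcal{M}$. In particular each $P_n$ is symmetric in its arguments, and for all elements: (1) if $x_i=x_j$ for some $i\neq j$ then $\neg P_n(x_1,\dots,x_n)$; (2) for $n>1$, $P_n(x_1,\dots,x_n)$ implies $P_{n-1}(x_1,\dots,x_{i-1},x_{i+1},\dots,x_n)$ for every $i$; (3) $P_n(x_1,\dots,x_n)\wedge P_{n+1}(y_1,\dots,y_{n+1})$ implies $\bigvee_{i=1}^{n+1}P_{n+1}(x_1,\dots,x_n,y_i)$. The direct power $\Pi\mathcal{A}=\prod_{i\in I}\mathcal{A}$ of a structure $\mathcal{A}$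 consists of all families $[a_i\mid i\in I]$ with $a_i\in\mathcal{A}$; relations are defined coordinate-wise (a relation holds in $\Pi\mathcal{A}$ iff it holds in every coordinate $i\in I$). A direct power of a matroid is an $\mathcal{L}_m$-structure that need not itself be a matroid. For an $\mathcal{L}$-structure $\mathcal{B}$, $\mathcal{L}(\mathcal{B})$ is the language $\mathcal{L}\cup\{b\mid b\in\mathcal{B}\}$ obtained by adding a constant symbol for every element of $\mathcal{B}$, interpreted by that element. An $\mathcal{L}(\mathcal{B})$-equation is an atomic formula of $\mathcal{L}(\mathcal{B})$ (equalities included). An $\mathcal{L}(\mathcal{B})$-system is an arbitrary set of $\mathcal{L}(\mathcal{B})$-equations in a finite set of variables $x_1,\dots,x_n$; its solution set over $\mathcal{B}$ is the set of points of $\mathcal{B}^n$ satisfying all its equations. Two systems in the same variables are equivalent over $\mathcal{B}$ if they have the same solution set. $\mathcal{B}$ is $\mathcal{L}(\mathcal{B})$-equationally Noetherian if every infinite $\mathcal{L}(\mathcal{B})$-system $\mathbf{S}$ is equivalent over $\mathcal{B}$ to some finite subsystem $\mathbf{S}'\subseteq\mathbf{S}$. *)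

theory Defs
  imports "HOL-Library.FuncSet"
begin

text \<open>
  Matroids on an arbitrary, possibly infinite, ground set. The finitary axiom is automatic when
  the ground set is finite.
\<close>

locale matroid =
  fixes E :: "'a set" and indep :: "'a set \<Rightarrow> bool"
  assumes indep_subset_ground: "indep X \<Longrightarrow> X \<subseteq> E"
    and indep_empty: "indep {}"
    and indep_mono: "indep Y \<Longrightarrow> X \<subseteq> Y \<Longrightarrow> indep X"
    and indep_augment:
      "indep X \<Longrightarrow> indep Y \<Longrightarrow> finite X \<Longrightarrow> finite Y \<Longrightarrow> card X < card Y \<Longrightarrow>
        \<exists>y\<in>Y - X. indep (insert y X)"
    and indep_finitary:
      "X \<subseteq> E \<Longrightarrow> (\<And>Y. Y \<subseteq> X \<Longrightarrow> finite Y \<Longrightarrow> indep Y) \<Longrightarrow> indep X"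

record 'p rel_language =
  symbols :: "'p set"
  arity :: "'p \<Rightarrow> nat"

record ('p, 'a) rel_structure =
  universe :: "'a set"
  interp :: "'p \<Rightarrow> 'a list \<Rightarrow> bool"

definition direct_power ::
    "'i set \<Rightarrow> ('p, 'a) rel_structure \<Rightarrow> ('p, 'i \<Rightarrow> 'a) rel_structure" where
  "direct_power I A =
    \<lparr> universe = I \<rightarrow>\<^sub>E universe A,
      interp = (\<lambda>p fs. \<forall>i\<in>I. interp A p (map (\<lambda>f. f i) fs)) \<rparr>"

text \<open>
  Atomic formulas of the language \<open>L(B)\<close>, for a relational language \<open>L\<close>. There are no function
  symbols, so a term is a variable \<open>x\<^sub>j\<close> or a constant naming an element of \<open>B\<close>.
\<close>

datatype 'b trm = Var nat | Const 'b

datatype ('p, 'b) eqn = Equal "'b trm" "'b trm" | Atom 'p "'b trm list"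

definition terms :: "('p, 'b) rel_structure \<Rightarrow> nat \<Rightarrow> 'b trm set" where
  "terms B n = Var ` {1..n} \<union> Const ` universe B"

definition equations ::
    "'p rel_language \<Rightarrow> ('p, 'b) rel_structure \<Rightarrow> nat \<Rightarrow> ('p, 'b) eqn set" where
  "equations L B n =
    {Equal s t | s t. s \<in> terms B n \<and> t \<in> terms B n} \<union>
    {Atom p ts | p ts. p \<in> symbols L \<and> length ts = arity L p \<and> set ts \<subseteq> terms B n}"

primrec trm_value :: "(nat \<Rightarrow> 'b) \<Rightarrow> 'b trm \<Rightarrow> 'b" where
  "trm_value v (Var j) = v j"
| "trm_value v (Const b) = b"

primrec satisfies :: "('p, 'b) rel_structure \<Rightarrow> (nat \<Rightarrow> 'b) \<Rightarrow> ('p, 'b) eqn \<Rightarrow> bool" where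
  "satisfies B v (Equal s t) \<longleftrightarrow> trm_value v s = trm_value v t"
| "satisfies B v (Atom p ts) \<longleftrightarrow> interp B p (map (trm_value v) ts)"

definition solutions ::
    "('p, 'b) rel_structure \<Rightarrow> nat \<Rightarrow> ('p, 'b) eqn set \<Rightarrow> (nat \<Rightarrow> 'b) set" where
  "solutions B n S = {v \<in> {1..n} \<rightarrow>\<^sub>E universe B. \<forall>e\<in>S. satisfies B v e}"

definition equationally_noetherian ::
    "'p rel_language \<Rightarrow> ('p, 'b) rel_structure \<Rightarrow> bool" where
  "equationally_noetherian L B \<longleftrightarrow>
    (\<forall>n S. S \<subseteq> equations L B n \<and> infinite S \<longrightarrow>
      (\<exists>S'\<subseteq>S. finite S' \<and> solutions B n S' = solutions B n S))"

text \<open>The symbol \<open>P\<^sub>n\<close> is represented by the number \<open>n \<ge> 1\<close>.\<close>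

definition matroid_language :: "nat rel_language" where
  "matroid_language = \<lparr> symbols = {1..}, arity = (\<lambda>n. n) \<rparr>"

definition matroid_structure :: "'a set \<Rightarrow> ('a set \<Rightarrow> bool) \<Rightarrow> (nat, 'a) rel_structure" where
  "matroid_structure E indep =
    \<lparr> universe = E,
      interp = (\<lambda>n xs. length xs = n \<and> distinct xs \<and> indep (set xs)) \<rparr>"

end

theory Submission
  imports Defs
begin

text \<open>
  The second axiom implies the first: if \<open>{a, b, c}\<close> is independent then \<open>a, b, c, a\<close> is a path for
  \<open>P\<^sub>2\<close>, but \<open>P\<^sub>2(a, a)\<close> fails. It says that \<open>P\<^sub>2\<close> has the rectangle property, so that two equations
  \<open>P\<^sub>2(x, c)\<close> and \<open>P\<^sub>2(x, d)\<close> have equal or disjoint solution sets, also over a power. The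
  \<open>P\<^sub>m\<close> with \<open>m \<ge> 3\<close> are empty. There are finitely many other equations up to a change of constants, and for each of these shapes at most two
  equations of the system matter. Conversely, let \<open>x\<^sub>1, x\<^sub>2, x\<^sub>3, x\<^sub>4\<close> be a path with \<open>x\<^sub>1\<close>
  not adjacent to \<open>x\<^sub>4\<close>, and let \<open>c\<^sub>i\<close> be \<open>x\<^sub>1\<close> at coordinate \<open>i\<close> and \<open>x\<^sub>3\<close> elsewhere. A
  point that is \<open>x\<^sub>2\<close> on a finite set of coordinates and \<open>x\<^sub>4\<close> outside it satisfies exactly the
  equations \<open>P\<^sub>2(x, c\<^sub>i)\<close> with \<open>i\<close> in that set.
\<close>

lemma solutions_antimono: "T \<subseteq> S \<Longrightarrow> solutions B n S \<subseteq> solutions B n T"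
  by (auto simp: solutions_def)

text \<open>By \<open>rect\<close>, solution sets of equations in one class are equal or disjoint.
  Take one representative per class; if these do not suffice, some \<open>e'\<close> fails where its
  representative holds, so the two are disjoint and adding \<open>e'\<close> makes the system
  inconsistent.\<close>

lemma finite_subsystem_if_finitely_many_classes:
  assumes fin: "finite (k ` S)"
    and rect: "\<And>e e' v w. \<lbrakk>e \<in> S; e' \<in> S; k e = k e'; satisfies B v e; satisfies B w e;
      satisfies B v e'\<rbrakk> \<Longrightarrow> satisfies B w e'"
  shows "\<exists>S'\<subseteq>S. finite S' \<and> solutions B n S' = solutions B n S"
proof -
  obtain T where T: "T \<subseteq> S" "finite T" "k ` S = k ` T"
    using finite_subset_image[OF fin order_refl] by metis
  show ?thesis
  proof (cases "solutions B n T = solutions B n S")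
    case False
    then obtain v where v: "v \<in> solutions B n T" "v \<notin> solutions B n S"
      using solutions_antimono[OF T(1)] by blast
    then obtain e' where e': "e' \<in> S" "\<not> satisfies B v e'"
      by (auto simp: solutions_def)
    then obtain e where e: "e \<in> T" "k e = k e'"
      using T(3) by (metis imageE imageI)
    have "satisfies B v e" using v e by (simp add: solutions_def)
    \<comment> \<open>A common solution \<open>w\<close> would let \<open>rect\<close>, with
      \<open>v\<close> and \<open>w\<close> exchanged, carry \<open>e'\<close> over to
      \<open>v\<close>.\<close>
    then have "\<not> (satisfies B w e \<and> satisfies B w e')" for w
      using rect[of e e' w v] e e' T(1) by blast
    then have "solutions B n (insert e' T) = {}"
      using e(1) by (auto simp: solutions_def)
    moreover have "insert e' T \<subseteq> S" using e' T by simp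
    ultimately show ?thesis
      using T(2) solutions_antimono[of "insert e' T" S B n]
      by (intro exI[of _ "insert e' T"]) auto
  qed (use T in blast)
qed

text \<open>Equations of equal shape differ only in their constants; these are the classes used
  below.\<close>

abbreviation shape :: "('p, 'b) eqn \<Rightarrow> ('p, unit) eqn" where
  "shape \<equiv> map_eqn id (\<lambda>_. ())"

lemma finite_shapes:
  assumes "S \<subseteq> equations L B n" "finite P"
    and "\<And>p ts. Atom p ts \<in> S \<Longrightarrow> p \<in> P"
  shows "finite (shape ` S)"
proof -
  define T where "T = insert (Const ()) (Var ` {1..n})"
  have T: "map_trm (\<lambda>_. ()) t \<in> T" if "t \<in> terms B n" for t
    using that by (auto simp: T_def terms_def)
  have "shape ` S \<subseteq> case_prod Equal ` (T \<times> T) \<union>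
      (\<Union>p\<in>P. Atom p ` {ts. set ts \<subseteq> T \<and> length ts = arity L p})"
  proof
    fix d assume "d \<in> shape ` S"
    then obtain e where e: "e \<in> S" "d = shape e" by auto
    then have "e \<in> equations L B n" using assms(1) by auto
    then show "d \<in> case_prod Equal ` (T \<times> T) \<union>
      (\<Union>p\<in>P. Atom p ` {ts. set ts \<subseteq> T \<and> length ts = arity L p})"
    proof (cases e)
      case (Equal s t)
      with e \<open>e \<in> equations L B n\<close> T show ?thesis
        by (auto simp: equations_def image_iff)
    next
      case (Atom p ts)
      with e \<open>e \<in> equations L B n\<close> have "p \<in> P" "set ts \<subseteq> terms B n" "length ts = arity L p"
        using assms(3) by (auto simp: equations_def)
      moreover have "d = Atom p (map (map_trm (\<lambda>_. ())) ts)" using e Atom by simp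
      ultimately show ?thesis by (intro UnI2 UN_I[of p] image_eqI) (auto intro!: T)
    qed
  qed
  moreover have "finite T" by (simp add: T_def)
  ultimately show ?thesis
    using assms(2) finite_lists_length_eq[of T] by (elim finite_subset) auto
qed

text \<open>With a variable on one side only and constants \<open>c\<close>, \<open>d\<close> on the
  other, the values of the variable give a path from \<open>w x\<close> through \<open>c\<close> and
  \<open>v x\<close> to \<open>d\<close>, which \<open>path\<close> closes. With two variables both
  equations coincide; with two constants the valuation is irrelevant.\<close>

lemma rectangle_binary:
  assumes path: "\<And>a b c d. \<lbrakk>R a b; R b c; R c d\<rbrakk> \<Longrightarrow> R d a"
    and sym: "\<And>a b. R a b \<Longrightarrow> R b a"
    and "map_trm (\<lambda>_. ()) s = map_trm (\<lambda>_. ()) s'" "map_trm (\<lambda>_. ()) t = map_trm (\<lambda>_. ()) t'"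
    and "R (trm_value v s) (trm_value v t)" "R (trm_value w s) (trm_value w t)"
      "R (trm_value v s') (trm_value v t')"
  shows "R (trm_value w s') (trm_value w t')"
  using assms(3-) by (cases s; cases s'; cases t; cases t') (simp_all, (meson path sym)+)

lemma rectangle_unary:
  assumes "map_trm (\<lambda>_. ()) s = map_trm (\<lambda>_. ()) s'"
    and "R (trm_value w s)" "R (trm_value v s')"
  shows "R (trm_value w s')"
  using assms by (cases s; cases s') auto

lemma equationally_noetherian_if_arity_le_2:
  assumes large: "\<And>p bs. 2 < p \<Longrightarrow> \<not> interp B p bs"
    and path: "\<And>a b c d. \<lbrakk>interp B 2 [a, b]; interp B 2 [b, c]; interp B 2 [c, d]\<rbrakk> \<Longrightarrow>
      interp B 2 [d, a]"
    and sym: "\<And>a b. interp B 2 [a, b] \<Longrightarrow> interp B 2 [b, a]"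
  shows "equationally_noetherian matroid_language B"
  unfolding equationally_noetherian_def
proof (intro allI impI)
  fix n S assume "S \<subseteq> equations matroid_language B n \<and> infinite S"
  then have S: "S \<subseteq> equations matroid_language B n" by simp
  show "\<exists>S'\<subseteq>S. finite S' \<and> solutions B n S' = solutions B n S"
  proof (cases "\<exists>p ts. Atom p ts \<in> S \<and> 2 < p")
    case True
    \<comment> \<open>This single equation is already inconsistent, hence equivalent to
      \<open>S\<close>.\<close>
    then obtain p ts where "Atom p ts \<in> S" "2 < p" by blast
    then show ?thesis
      using large by (intro exI[of _ "{Atom p ts}"]) (auto simp: solutions_def intro!: bexI[of _ "Atom p ts"])
  next
    case False
    have arity: "p \<in> {1, 2} \<and> length ts = p" if "Atom p ts \<in> S" for p ts
    proof -
      have "Atom p ts \<in> equations matroid_language B n" using S that by blast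
      moreover have "p \<le> 2" using False that by (meson not_le)
      ultimately show ?thesis by (auto simp: equations_def matroid_language_def)
    qed
    show ?thesis
    proof (rule finite_subsystem_if_finitely_many_classes[of shape])
      show "finite (shape ` S)"
        by (rule finite_shapes[OF S, of "{1, 2}"]) (use arity in auto)
    next
      fix e e' v w
      assume mem: "e \<in> S" "e' \<in> S" and shape: "shape e = shape e'"
        and sat: "satisfies B v e" "satisfies B w e" "satisfies B v e'"
      show "satisfies B w e'"
      proof (cases e')
        case (Equal s' t')
        then obtain s t where st: "e = Equal s t" using shape by (cases e) auto
        \<comment> \<open>Equality, being an equivalence relation, has the path property as
          well.\<close>
        show ?thesis
          using rectangle_binary[of "(=)" s s' t t' v w] shape sat Equal st by auto
      next
        case (Atom p ts')
        then obtain ts where ts: "e = Atom p ts" using shape by (cases e) auto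
        have eq: "map (map_trm (\<lambda>_. ())) ts = map (map_trm (\<lambda>_. ())) ts'"
          using shape Atom ts by simp
        consider "p = 1" "length ts = 1" "length ts' = 1" |
          "p = 2" "length ts = 2" "length ts' = 2"
          using arity mem Atom ts by blast
        then show ?thesis
        proof cases
          case 1
          then obtain s s' where s: "ts = [s]" "ts' = [s']"
            by (auto simp: length_Suc_conv)
          with eq sat Atom ts show ?thesis
            using rectangle_unary[of s s' "\<lambda>x. interp B p [x]" w v] by simp
        next
          case 2
          then obtain s t s' t' where s: "ts = [s, t]" "ts' = [s', t']"
            by (auto simp: length_Suc_conv numeral_2_eq_2)
          have "interp B 2 [trm_value w s', trm_value w t']"
          proof (rule rectangle_binary[of "\<lambda>x y. interp B 2 [x, y]" s s' t t' v w])
            show "interp B 2 [d, a]"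
              if "interp B 2 [a, b]" "interp B 2 [b, c]" "interp B 2 [c, d]" for a b c d
              using that by (rule path)
            show "interp B 2 [b, a]" if "interp B 2 [a, b]" for a b
              using that by (rule sym)
          qed (use 2 s eq sat Atom ts in simp_all)
          then show ?thesis using 2 s Atom by simp
        qed
      qed
    qed
  qed
qed

lemma power_noetherian_imp_path:
  fixes I :: "'i set" and M :: "(nat, 'a) rel_structure"
  assumes I: "infinite I"
    and noeth: "equationally_noetherian matroid_language (direct_power I M)"
    and sym: "\<And>a b. interp M 2 [a, b] \<Longrightarrow> interp M 2 [b, a]"
    and univ: "x1 \<in> universe M" "x2 \<in> universe M" "x3 \<in> universe M" "x4 \<in> universe M"
    and path: "interp M 2 [x1, x2]" "interp M 2 [x2, x3]" "interp M 2 [x3, x4]"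
  shows "interp M 2 [x4, x1]"
proof (rule ccontr)
  assume not_adj: "\<not> interp M 2 [x4, x1]"
  let ?B = "direct_power I M"
  define c where "c i = (\<lambda>j\<in>I. if j = i then x1 else x3)" for i :: 'i
  define e where "e i = Atom (2::nat) [Var 1, Const (c i)]" for i
  \<comment> \<open>This makes the \<open>c i\<close> distinct, so that the system is
    infinite.\<close>
  have "x1 \<noteq> x3" using not_adj sym[OF path(3)] by blast
  have "inj_on e I"
  proof
    fix i j assume ij: "i \<in> I" "j \<in> I" "e i = e j"
    then have "c i i = c j i" by (simp add: e_def)
    then show "i = j" using ij(1) \<open>x1 \<noteq> x3\<close> by (auto simp: c_def split: if_splits)
  qed
  then have "infinite (e ` I)" using I by (simp add: finite_image_iff)
  moreover have "e ` I \<subseteq> equations matroid_language ?B 1"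
    using univ
    by (auto simp: e_def c_def equations_def matroid_language_def terms_def direct_power_def)
  ultimately obtain S' where S': "S' \<subseteq> e ` I" "finite S'"
      "solutions ?B 1 S' = solutions ?B 1 (e ` I)"
    using noeth unfolding equationally_noetherian_def by meson
  then obtain J where J: "J \<subseteq> I" "finite J" "S' = e ` J"
    using finite_subset_image by metis
  obtain k where k: "k \<in> I" "k \<notin> J" using J I by (meson finite_subset subsetI)
  define f where "f = (\<lambda>j\<in>I. if j \<in> J then x2 else x4)"
  define v where "v = (\<lambda>m\<in>{1..1::nat}. f)"
  have v1: "v 1 = f" by (simp add: v_def)
  \<comment> \<open>On \<open>J\<close> the value \<open>x2\<close> is adjacent to both
    \<open>x1\<close> and \<open>x3\<close>; off \<open>J\<close> the value \<open>x4\<close> only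
    meets \<open>x3\<close>, since \<open>i\<close> lies in \<open>J\<close>. At \<open>k\<close>,
    however, \<open>x4\<close> meets \<open>x1\<close>.\<close>
  have "satisfies ?B v (e i)" if "i \<in> J" for i
    using that path sym[OF path(1)] sym[OF path(3)] v1
    by (auto simp: e_def c_def f_def direct_power_def)
  moreover have "v \<in> {1..1} \<rightarrow>\<^sub>E universe ?B"
    using univ by (auto simp: v_def f_def direct_power_def)
  ultimately have "v \<in> solutions ?B 1 (e ` I)"
    using S'(3) J(3) by (auto simp: solutions_def)
  then have "satisfies ?B v (e k)" using k by (auto simp: solutions_def)
  then have "interp M 2 [f k, c k k]"
    using k(1) v1 by (auto simp: e_def direct_power_def)
  then show False using k not_adj by (simp add: f_def c_def)
qed

context matroid
begin

lemma interp_2_iff: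
  "interp (matroid_structure E indep) 2 [a, b] \<longleftrightarrow> a \<noteq> b \<and> indep {a, b}"
  by (simp add: matroid_structure_def)

lemma interp_3_iff:
  "interp (matroid_structure E indep) 3 [a, b, c] \<longleftrightarrow> distinct [a, b, c] \<and> indep {a, b, c}"
  by (auto simp: matroid_structure_def)

lemma interp_2_sym:
  "interp (matroid_structure E indep) 2 [a, b] \<Longrightarrow> interp (matroid_structure E indep) 2 [b, a]"
  by (auto simp: interp_2_iff insert_commute)

text \<open>Independence is hereditary, so the first three entries serve.\<close>

lemma interp_large_imp_interp_3:
  assumes "interp (matroid_structure E indep) p xs" "2 < p"
  shows "\<exists>a\<in>E. \<exists>b\<in>E. \<exists>c\<in>E. interp (matroid_structure E indep) 3 [a, b, c]"
proof -
  have xs: "length xs = p" "distinct xs" "indep (set xs)"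
    using assms(1) by (auto simp: matroid_structure_def)
  then obtain a b c ys where "xs = a # b # c # ys"
    using assms(2) by (metis Suc_le_length_iff Suc_leI numeral_2_eq_2)
  then have "distinct [a, b, c]" "indep {a, b, c}"
    using xs indep_mono[of "set xs" "{a, b, c}"] by auto
  then show ?thesis
    using indep_subset_ground[of "{a, b, c}"] interp_3_iff by auto
qed

end

theorem theorem5p2:
  fixes E :: "'a set" and indep :: "'a set \<Rightarrow> bool" and I :: "'i set"
  assumes "matroid E indep" and "infinite I"
  defines "M \<equiv> matroid_structure E indep"
  shows "equationally_noetherian matroid_language (direct_power I M) \<longleftrightarrow>
    (\<forall>x\<in>universe M. \<forall>y\<in>universe M. \<forall>z\<in>universe M. \<not> interp M 3 [x, y, z]) \<and>
    (\<forall>x1\<in>universe M. \<forall>x2\<in>universe M. \<forall>x3\<in>universe M. \<forall>x4\<in>universe M.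
      interp M 2 [x1, x2] \<and> interp M 2 [x2, x3] \<and> interp M 2 [x3, x4] \<longrightarrow> interp M 2 [x4, x1])"
    (is "?N \<longleftrightarrow> ?A1 \<and> ?A2")
proof -
  interpret matroid E indep by fact
  have univ: "universe M = E" by (simp add: M_def matroid_structure_def)
  have sym: "interp M 2 [a, b] \<Longrightarrow> interp M 2 [b, a]" for a b
    unfolding M_def by (rule interp_2_sym)
  \<comment> \<open>Frees the path axiom from its bounded quantifiers, as the general criterion asks
    for it at arbitrary elements.\<close>
  have ground: "a \<in> E \<and> b \<in> E" if "interp M 2 [a, b]" for a b
    using that indep_subset_ground[of "{a, b}"] by (simp add: M_def interp_2_iff)
  show ?thesis
  proof
    assume ?N
    then have ?A2
      using power_noetherian_imp_path[OF \<open>infinite I\<close>, of M] sym by blast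
    moreover have ?A1
    proof (intro ballI notI)
      fix x y z assume xyz: "x \<in> universe M" "y \<in> universe M" "z \<in> universe M" "interp M 3 [x, y, z]"
      then have ind: "distinct [x, y, z]" "indep {x, y, z}" by (simp_all only: M_def interp_3_iff)
      have "indep {x, y}" "indep {y, z}" "indep {z, x}"
        by (auto intro: indep_mono[OF ind(2)])
      then have "interp M 2 [x, y]" "interp M 2 [y, z]" "interp M 2 [z, x]"
        using ind(1) by (auto simp: M_def interp_2_iff)
      then have "interp M 2 [x, x]" using \<open>?A2\<close> xyz by blast
      then show False by (simp add: M_def interp_2_iff)
    qed
    ultimately show "?A1 \<and> ?A2" by blast
  next
    assume A: "?A1 \<and> ?A2"
    \<comment> \<open>One coordinate refutes \<open>P_m\<close> with m > 2 in the power; over an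
      empty index set every relation would hold.\<close>
    obtain i where i: "i \<in> I" using \<open>infinite I\<close> by fastforce
    have path: "interp M 2 [d, a]"
      if "interp M 2 [a, b]" "interp M 2 [b, c]" "interp M 2 [c, d]" for a b c d
      using A ground that univ by blast
    show ?N
    proof (rule equationally_noetherian_if_arity_le_2)
      fix p :: nat and fs assume "2 < p"
      then show "\<not> interp (direct_power I M) p fs"
        using interp_large_imp_interp_3 A i univ by (auto simp: direct_power_def M_def)
    next
      fix f g assume "interp (direct_power I M) 2 [f, g]"
      then show "interp (direct_power I M) 2 [g, f]"
        by (auto simp: direct_power_def intro: sym)
    next
      \<comment> \<open>A Horn condition passes to the power coordinate by coordinate.\<close>
      fix f g h k
      assume "interp (direct_power I M) 2 [f, g]" "interp (direct_power I M) 2 [g, h]"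
        "interp (direct_power I M) 2 [h, k]"
      then show "interp (direct_power I M) 2 [k, f]"
        using path by (simp add: direct_power_def) blast
    qed
  qed
qed

end
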